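(* Let $\Bbbk$ be a field, let $n$ be a positive integer, and let $\mathcal{A}$ be an affine hyperplane arrangement in $\Bbbk^n$. Let $\mathcal{C}_{\mathcal{A}}$ be the collection of central subarrangements of $\mathcal{A}$, and let $r_{\mathcal{A}}$ be the rank function of $\mathcal{A}$. Then $(\mathcal{A},\mathcal{C}_{\mathcal{A}},r_{\mathcal{A}})$ is a semimatroid.
   Context: An affine hyperplane in $\Bbbk^n$ is an $(n-1)$-dimensional affine subspace, and a hyperplane arrangement is a finite set of affine hyperplanes in $\Bbbk^n$. A subset $\mathcal{B}\subseteq\mathcal{A}$ is central if the hyperplanes in $\mathcal{B}$ have non-empty intersection $\cap\mathcal{B}$ (with $\cap\emptyset=\Bbbk^n$). For central $\mathcal{B}$, $r_{\mathcal{A}}(\mathcal{B})=n-\dim\cap\mathcal{B}$. $\mathbb{N}$ includes $0$. A simplicial complex on a finite set $S$ is a family of subsets of $S$ closed under taking subsets. A semimatroid is a triple $(S,\mathcal{C},r_{\mathcal{C}})$ consisting of a finite set $S$, a non-empty simplicial complex $\mathcal{C}$ on $S$, and a function $r_{\mathcal{C}}:\mathcal{C}\to\mathbb{N}$ such that: (R1) if $X\in\mathcal{C}$ then $0\le r_{\mathcal{C}}(X)\le |X|$; (R2) if $X,Y\in\mathcal{C}$ and $X\subseteq Y$ then $r_{\mathcal{C}}(X)\le r_{\mathcal{C}}(Y)$; (R3) if $X,Y\in\mathcal{C}$ and $X\cup Y\in\mathcal{C}$ then $r_{\mathcal{C}}(X)+r_{\mathcal{C}}(Y)\ge r_{\mathcal{C}}(X\cup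 Y)+r_{\mathcal{C}}(X\cap Y)$; (CR1) if $X,Y\in\mathcal{C}$ and $r_{\mathcal{C}}(X)=r_{\mathcal{C}}(X\cap Y)$ then $X\cup Y\in\mathcal{C}$; (CR2) if $X,Y\in\mathcal{C}$ and $r_{\mathcal{C}}(X)<r_{\mathcal{C}}(Y)$ then $X\cup\{y\}\in\mathcal{C}$ for some $y\in Y-X$. *)

theory Defs
  imports "HOL-Analysis.Cartesian_Space"
begin

subsection \<open>Semimatroids\<close>

definition simplicial_complex_on :: "'e set \<Rightarrow> 'e set set \<Rightarrow> bool" where
  "simplicial_complex_on S C \<longleftrightarrow>
     (\<forall>X\<in>C. X \<subseteq> S) \<and> (\<forall>X\<in>C. \<forall>Y. Y \<subseteq> X \<longrightarrow> Y \<in> C)"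

text \<open>The rank function of a semimatroid has domain \<open>C\<close>; here it is a total function whose
  values outside \<open>C\<close> are unconstrained.  In \<open>R3\<close> and \<open>CR1\<close> the set \<open>X \<inter> Y\<close> lies in \<open>C\<close>
  because \<open>C\<close> is closed under subsets.\<close>

locale semimatroid =
  fixes S :: "'e set" and C :: "'e set set" and r :: "'e set \<Rightarrow> nat"
  assumes finite_ground: "finite S"
    and complex: "simplicial_complex_on S C"
    and nonempty: "C \<noteq> {}"
    and R1: "X \<in> C \<Longrightarrow> 0 \<le> r X \<and> r X \<le> card X"
    and R2: "X \<in> C \<Longrightarrow> Y \<in> C \<Longrightarrow> X \<subseteq> Y \<Longrightarrow> r X \<le> r Y"
    and R3: "X \<in> C \<Longrightarrow> Y \<in> C \<Longrightarrow> X \<union> Y \<in> C \<Longrightarrow> r (X \<union> Y) + r (X \<inter> Y) \<le> r X + r Y"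
    and CR1: "X \<in> C \<Longrightarrow> Y \<in> C \<Longrightarrow> r X = r (X \<inter> Y) \<Longrightarrow> X \<union> Y \<in> C"
    and CR2: "X \<in> C \<Longrightarrow> Y \<in> C \<Longrightarrow> r X < r Y \<Longrightarrow> \<exists>y\<in>Y - X. X \<union> {y} \<in> C"

subsection \<open>Affine subspaces over an arbitrary field\<close>

text \<open>The library constants \<open>affine\<close> and \<open>aff_dim\<close> are restricted to real vector spaces, so
  affine subspaces are introduced as translates of linear subspaces; in particular they are
  nonempty.\<close>

definition affine_subspace :: "('a::field ^ 'n) set \<Rightarrow> bool" where
  "affine_subspace F \<longleftrightarrow> (\<exists>p W. vec.subspace W \<and> F = (\<lambda>w. p + w) ` W)"

definition direction :: "('a::field ^ 'n) set \<Rightarrow> ('a ^ 'n) set" where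
  "direction F = {x - y | x y. x \<in> F \<and> y \<in> F}"

definition affine_dim :: "('a::field ^ 'n) set \<Rightarrow> nat" where
  "affine_dim F = vec.dim (direction F)"

lemma direction_translate:
  assumes "vec.subspace W"
  shows "direction ((\<lambda>w. p + w) ` W) = W"
proof
  show "direction ((\<lambda>w. p + w) ` W) \<subseteq> W"
    using assms by (auto simp: direction_def vec.subspace_diff)
  show "W \<subseteq> direction ((\<lambda>w. p + w) ` W)"
  proof
    fix w assume "w \<in> W"
    moreover have "0 \<in> W" using assms by (rule vec.subspace_0)
    moreover have "w = (p + w) - (p + 0)" by simp
    ultimately show "w \<in> direction ((\<lambda>w. p + w) ` W)"
      unfolding direction_def by blast
  qed
qed

lemma affine_dim_translate:
  "vec.subspace W \<Longrightarrow> affine_dim ((\<lambda>w. p + w) ` W) = vec.dim W"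
  by (simp add: affine_dim_def direction_translate)

lemma affine_dim_le: "affine_dim (F :: ('a::field ^ 'n) set) \<le> CARD('n)"
  unfolding affine_dim_def using vec.dim_subset_UNIV[of "direction F"]
  by (simp add: vec.dimension_def card_cart_basis)

subsection \<open>Hyperplane arrangements\<close>

definition affine_hyperplane :: "('a::field ^ 'n) set \<Rightarrow> bool" where
  "affine_hyperplane H \<longleftrightarrow> affine_subspace H \<and> affine_dim H = CARD('n) - 1"

definition hyperplane_arrangement :: "('a::field ^ 'n) set set \<Rightarrow> bool" where
  "hyperplane_arrangement A \<longleftrightarrow> finite A \<and> (\<forall>H\<in>A. affine_hyperplane H)"

text \<open>Note that \<open>\<Inter>{} = UNIV\<close>.\<close>

definition central_subarrangements :: "('a ^ 'n) set set \<Rightarrow> ('a ^ 'n) set set set" where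
  "central_subarrangements A = {B. B \<subseteq> A \<and> \<Inter>B \<noteq> {}}"

text \<open>The ambient arrangement enters the rank function only through its domain.  By
  \<open>affine_dim_le\<close> the subtraction is never truncated.\<close>

definition arrangement_rank :: "('a::field ^ 'n) set set \<Rightarrow> nat" where
  "arrangement_rank B = CARD('n) - affine_dim (\<Inter>B)"

end

theory Submission
  imports Defs
begin

text \<open>A central arrangement with a common point \<open>p\<close> is the translate by \<open>p\<close> of the linear
  arrangement of its directions, so its rank is the codimension of the intersection of the
  directions, and the rank axioms follow from \<open>dim (U + W) + dim (U \<inter> W) = dim U + dim W\<close>.
  For \<open>CR1\<close>, equal ranks force \<open>\<Inter>X = \<Inter>(X \<inter> Y)\<close>, hence \<open>\<Inter>Y \<subseteq> \<Inter>X\<close>.  For \<open>CR2\<close>, a flat that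
  misses a hyperplane is parallel to it; if \<open>\<Inter>X\<close> missed or lay in every hyperplane of \<open>Y\<close>,
  its direction would lie in that of \<open>\<Inter>Y\<close>, and \<open>r X \<ge> r Y\<close>.\<close>

lemma mem_translate_iff:
  "x \<in> (\<lambda>w. p + w) ` W \<longleftrightarrow> x - p \<in> W" for p :: "'b::ab_group_add"
proof
  assume "x - p \<in> W"
  moreover have "x = p + (x - p)" by simp
  ultimately show "x \<in> (\<lambda>w. p + w) ` W" by (rule rev_image_eqI)
qed auto

text \<open>Any point of \<open>F\<close> can serve as base point: replacing \<open>q\<close> by
  \<open>p\<close> shifts differences by \<open>p - q\<close>, which lies in the direction.\<close>

lemma mem_affine_subspace_iff:
  assumes "affine_subspace F" "p \<in> F"
  shows "x \<in> F \<longleftrightarrow> x - p \<in> direction F"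
proof -
  obtain q W where W: "vec.subspace W" and F: "F = (\<lambda>w. q + w) ` W"
    using assms(1) unfolding affine_subspace_def by blast
  have dir: "direction F = W"
    using W F direction_translate by blast
  have mem: "y \<in> F \<longleftrightarrow> y - q \<in> W" for y
    unfolding F by (rule mem_translate_iff)
  have p: "p - q \<in> W" using assms(2) mem by simp
  show ?thesis
  proof
    assume "x \<in> F"
    then have "(x - q) - (p - q) \<in> W"
      using mem p by (blast intro: vec.subspace_diff[OF W])
    then show "x - p \<in> direction F" by (simp add: dir)
  next
    assume "x - p \<in> direction F"
    then have "(x - p) + (p - q) \<in> W"
      using p unfolding dir by (rule vec.subspace_add[OF W])
    then show "x \<in> F" by (simp add: mem)
  qed
qed

lemma affine_subspace_nonempty: "affine_subspace F \<Longrightarrow> F \<noteq> {}"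
  unfolding affine_subspace_def using vec.subspace_0 by auto

lemma subspace_direction:
  assumes "affine_subspace F"
  shows "vec.subspace (direction F)"
  using assms direction_translate unfolding affine_subspace_def by metis

lemma affine_subspace_eq_translate:
  assumes "affine_subspace F" "p \<in> F"
  shows "F = (\<lambda>w. p + w) ` direction F"
  by (rule set_eqI) (simp only: mem_translate_iff mem_affine_subspace_iff[OF assms])

text \<open>With the common point \<open>p\<close> as base point of every member, intersecting the
  translates amounts to intersecting the directions. An empty \<open>B\<close> yields
  \<open>UNIV\<close> on both sides.\<close>

lemma affine_subspace_Inter:
  assumes "\<forall>F\<in>B. affine_subspace F" "p \<in> \<Inter>B"
  shows "affine_subspace (\<Inter>B)" and "direction (\<Inter>B) = (\<Inter>F\<in>B. direction F)"
proof -
  let ?W = "\<Inter>F\<in>B. direction F"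
  have W: "vec.subspace ?W"
    using assms(1) by (intro vec.subspace_Inter) (auto simp: subspace_direction)
  have "x \<in> \<Inter>B \<longleftrightarrow> x - p \<in> ?W" for x
    using assms mem_affine_subspace_iff by blast
  then have eq: "\<Inter>B = (\<lambda>w. p + w) ` ?W"
    by (intro set_eqI) (simp only: mem_translate_iff)
  show "affine_subspace (\<Inter>B)"
    using W eq unfolding affine_subspace_def by blast
  show "direction (\<Inter>B) = ?W"
    using W by (subst eq) (rule direction_translate)
qed

lemma dim_le_CARD: "vec.dim (W :: ('a::field ^ 'n) set) \<le> CARD('n)"
  using vec.dim_subset_UNIV[of W] by (simp add: vec.dimension_def card_cart_basis)

text \<open>Each further hyperplane lowers the dimension by at most one, because its sum with the
  previous intersection has dimension at most \<open>CARD('n)\<close>. The family is indexed because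
  distinct parallel hyperplanes share a direction, and the bound is to count hyperplanes.\<close>

lemma CARD_le_dim_Int_hyperplanes:
  fixes D :: "'i \<Rightarrow> ('a::field ^ 'n) set"
  assumes "finite I" "\<And>i. i \<in> I \<Longrightarrow> vec.subspace (D i)"
    and "\<And>i. i \<in> I \<Longrightarrow> vec.dim (D i) = CARD('n) - 1"
  shows "CARD('n) \<le> vec.dim (\<Inter>i\<in>I. D i) + card I"
  using assms
proof (induction I rule: finite_induct)
  case empty
  then show ?case by (simp add: card_cart_basis)
next
  case (insert i I)
  let ?V = "\<Inter>j\<in>I. D j"
  have V: "vec.subspace ?V"
    using insert.prems by (intro vec.subspace_Inter) auto
  have "vec.dim {x + y | x y. x \<in> D i \<and> y \<in> ?V} + vec.dim (D i \<inter> ?V)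
      = vec.dim (D i) + vec.dim ?V"
    using insert.prems V by (intro vec.dim_sums_Int) auto
  moreover have "vec.dim {x + y | x y. x \<in> D i \<and> y \<in> ?V} \<le> CARD('n)"
    by (rule dim_le_CARD)
  moreover have "vec.dim (D i) = CARD('n) - 1" "CARD('n) \<le> vec.dim ?V + card I"
    using insert by auto
  \<comment> \<open>This makes \<open>CARD('n) - 1\<close> a genuine predecessor in the natural
    numbers.\<close>
  moreover have "0 < CARD('n)" by simp
  ultimately show ?case using insert.hyps by simp
qed

text \<open>The two directions together span the whole space, so the difference of a point of
  \<open>F\<close> and a point of \<open>H\<close> splits into a move along \<open>F\<close> and a
  move along \<open>H\<close>; after these moves the points coincide.\<close>

lemma affine_hyperplane_meets:
  fixes F H :: "('a::field ^ 'n) set"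
  assumes F: "affine_subspace F" and H: "affine_hyperplane H"
    and W: "\<not> direction F \<subseteq> direction H"
  shows "F \<inter> H \<noteq> {}"
proof -
  let ?S = "{x + y | x y. x \<in> direction F \<and> y \<in> direction H}"
  have aH: "affine_subspace H" and dH: "vec.dim (direction H) = CARD('n) - 1"
    using H by (auto simp: affine_hyperplane_def affine_dim_def)
  note sF = subspace_direction[OF F] and sH = subspace_direction[OF aH]
  have S: "vec.subspace ?S"
    using sF sH by (rule vec.subspace_sums)
  have "direction H \<subseteq> ?S"
    using vec.subspace_0[OF sF] by force
  moreover have "direction F \<subseteq> ?S"
    using vec.subspace_0[OF sH] by force
  \<comment> \<open>Otherwise \<open>?S\<close> would equal \<open>direction H\<close>, which would
    then contain \<open>direction F\<close>.\<close>
  ultimately have "\<not> vec.dim ?S \<le> vec.dim (direction H)"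
    using vec.subspace_dim_equal[OF sH S] W by blast
  then have "vec.dim ?S \<ge> CARD('n)"
    using dH by simp
  then have full: "?S = UNIV"
    using vec.subspace_dim_equal[OF S vec.subspace_UNIV] by (simp add: card_cart_basis)
  obtain p q where p: "p \<in> F" and q: "q \<in> H"
    using affine_subspace_nonempty[OF F] affine_subspace_nonempty[OF aH] by blast
  have "q - p \<in> ?S" by (simp add: full)
  then obtain w d where w: "w \<in> direction F" and d: "d \<in> direction H" and "q - p = w + d"
    by blast
  then have "p + w = q - d" by (simp add: algebra_simps)
  moreover have "p + w \<in> F"
    using w by (simp add: mem_affine_subspace_iff[OF F p])
  moreover have "q - d \<in> H"
    using d sH by (simp add: mem_affine_subspace_iff[OF aH q] vec.subspace_neg)
  ultimately show ?thesis by auto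
qed

lemma direction_subset_if_inessential:
  fixes F H :: "('a::field ^ 'n) set"
  assumes "affine_subspace F" "affine_hyperplane H" "F \<subseteq> H \<or> F \<inter> H = {}"
  shows "direction F \<subseteq> direction H"
proof (cases "F \<subseteq> H")
  case True
  then show ?thesis unfolding direction_def by blast
next
  case False
  then show ?thesis using assms affine_hyperplane_meets by blast
qed

theorem proposition2p2:
  fixes A :: "('a::field ^ 'n) set set"
  assumes "hyperplane_arrangement A"
  shows "semimatroid A (central_subarrangements A) arrangement_rank"
proof -
  let ?C = "central_subarrangements A"
  \<comment> \<open>For central \<open>B\<close> this is the direction of \<open>\<Inter>B\<close>.
    Unlike that direction, it is antitone and turns unions into intersections for arbitrary
    \<open>B\<close>.\<close>
  define D :: "('a ^ 'n) set set \<Rightarrow> ('a ^ 'n) set" where "D B = (\<Inter>H\<in>B. direction H)" for B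
  have fin: "finite A" and hyp: "H \<in> A \<Longrightarrow> affine_hyperplane H" for H
    using assms by (auto simp: hyperplane_arrangement_def)
  have aff: "affine_subspace H" and dimH: "vec.dim (direction H) = CARD('n) - 1"
    if "H \<in> A" for H
    using hyp[OF that] by (auto simp: affine_hyperplane_def affine_dim_def)
  have C: "B \<in> ?C \<longleftrightarrow> B \<subseteq> A \<and> \<Inter>B \<noteq> {}" for B
    by (simp add: central_subarrangements_def)
  have sub: "Y \<in> ?C" if "X \<in> ?C" "Y \<subseteq> X" for X Y
    using that Inter_anti_mono[of Y X] by (auto simp: C)
  have flat: "affine_subspace (\<Inter>B)" and dir: "direction (\<Inter>B) = D B" if B: "B \<in> ?C" for B
  proof -
    obtain p where "p \<in> \<Inter>B" using B by (auto simp: C)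
    moreover have "\<forall>F\<in>B. affine_subspace F" using B aff by (auto simp: C)
    ultimately show "affine_subspace (\<Inter>B)" "direction (\<Inter>B) = D B"
      using affine_subspace_Inter[of B p] by (simp_all add: D_def)
  qed
  have sD: "vec.subspace (D B)" if "B \<in> ?C" for B
    using subspace_direction[OF flat[OF that]] by (simp add: dir[OF that])
  \<comment> \<open>Written as a sum, so that dimension inequalities become rank inequalities
    without truncated subtraction.\<close>
  have rank: "arrangement_rank B + vec.dim (D B) = CARD('n)" if "B \<in> ?C" for B
    using dim_le_CARD[of "D B"] by (simp add: arrangement_rank_def affine_dim_def dir[OF that])
  have D_mono: "D Y \<subseteq> D X" if "X \<subseteq> Y" for X Y
    using that unfolding D_def by blast
  show ?thesis
  proof
    show "finite A" by (rule fin)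
    show "simplicial_complex_on A ?C"
      unfolding simplicial_complex_on_def
    proof (intro conjI ballI allI impI)
      show "X \<subseteq> A" if "X \<in> ?C" for X using that by (simp add: C)
    qed (rule sub)
    have "{} \<in> ?C" by (simp add: C)
    then show "?C \<noteq> {}" by blast
  next
    fix X assume X: "X \<in> ?C"
    then have XA: "X \<subseteq> A" by (simp add: C)
    then have "CARD('n) \<le> vec.dim (D X) + card X"
      unfolding D_def using aff dimH
      by (intro CARD_le_dim_Int_hyperplanes finite_subset[OF _ fin] subspace_direction) auto
    then show "0 \<le> arrangement_rank X \<and> arrangement_rank X \<le> card X"
      using rank[OF X] by linarith
  next
    fix X Y assume X: "X \<in> ?C" and Y: "Y \<in> ?C" and "X \<subseteq> Y"
    then show "arrangement_rank X \<le> arrangement_rank Y"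
      using rank[OF X] rank[OF Y] vec.dim_subset[OF D_mono[of X Y]] by linarith
  next
    fix X Y assume X: "X \<in> ?C" and Y: "Y \<in> ?C" and U: "X \<union> Y \<in> ?C"
    let ?S = "{x + y | x y. x \<in> D X \<and> y \<in> D Y}"
    have I: "X \<inter> Y \<in> ?C" using sub[OF X] by blast
    have "vec.dim ?S + vec.dim (D X \<inter> D Y) = vec.dim (D X) + vec.dim (D Y)"
      using sD[OF X] sD[OF Y] by (rule vec.dim_sums_Int)
    moreover have "D X \<inter> D Y = D (X \<union> Y)"
      unfolding D_def by blast
    \<comment> \<open>This inclusion can be strict, which is why submodularity is only an
      inequality.\<close>
    moreover have "?S \<subseteq> D (X \<inter> Y)"
      using D_mono[of "X \<inter> Y" X] D_mono[of "X \<inter> Y" Y] vec.subspace_add[OF sD[OF I]] by blast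
    then have "vec.dim ?S \<le> vec.dim (D (X \<inter> Y))"
      by (rule vec.dim_subset)
    ultimately show "arrangement_rank (X \<union> Y) + arrangement_rank (X \<inter> Y)
        \<le> arrangement_rank X + arrangement_rank Y"
      using rank[OF X] rank[OF Y] rank[OF U] rank[OF I] by simp
  next
    fix X Y assume X: "X \<in> ?C" and Y: "Y \<in> ?C"
      and eq: "arrangement_rank X = arrangement_rank (X \<inter> Y)"
    have I: "X \<inter> Y \<in> ?C" using sub[OF X] by blast
    have "vec.dim (D (X \<inter> Y)) \<le> vec.dim (D X)"
      using rank[OF X] rank[OF I] eq by linarith
    then have "D X = D (X \<inter> Y)"
      using vec.subspace_dim_equal[OF sD[OF X] sD[OF I] D_mono] by blast
    \<comment> \<open>Two affine subspaces with the same direction and a common point coincide;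
      \<open>p\<close> is that point for \<open>\<Inter>X\<close> and
      \<open>\<Inter>(X \<inter> Y)\<close>.\<close>
    moreover obtain p where p: "p \<in> \<Inter>X" using X by (auto simp: C)
    moreover from p have "p \<in> \<Inter>(X \<inter> Y)" by blast
    ultimately have "\<Inter>X = \<Inter>(X \<inter> Y)"
      using affine_subspace_eq_translate[OF flat[OF X], of p]
        affine_subspace_eq_translate[OF flat[OF I], of p] dir[OF X] dir[OF I] by simp
    then have "\<Inter>(X \<union> Y) = \<Inter>Y"
      unfolding Inter_Un_distrib by blast
    then show "X \<union> Y \<in> ?C"
      using X Y by (simp add: C)
  next
    fix X Y assume X: "X \<in> ?C" and Y: "Y \<in> ?C"
      and less: "arrangement_rank X < arrangement_rank Y"
    show "\<exists>y\<in>Y - X. X \<union> {y} \<in> ?C"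
    proof (rule ccontr)
      assume contra: "\<not> ?thesis"
      have "D X \<subseteq> direction H" if "H \<in> Y" for H
      proof -
        have HA: "H \<in> A" using that Y by (auto simp: C)
        \<comment> \<open>A member of \<open>X\<close> contains the flat; for \<open>H\<close>
          outside \<open>X\<close>, the failed exchange says that \<open>X \<union> {H}\<close> is
          not central, so \<open>H\<close> misses the flat.\<close>
        have "\<Inter>X \<subseteq> H \<or> \<Inter>X \<inter> H = {}"
        proof (cases "H \<in> X")
          case False
          then have "X \<union> {H} \<notin> ?C" using contra that by blast
          then have "\<Inter>(X \<union> {H}) = {}" using X HA by (auto simp: C)
          then show ?thesis by (simp add: Int_commute)
        qed blast
        then show ?thesis
          using direction_subset_if_inessential[OF flat[OF X] hyp[OF HA]] dir[OF X] by simp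
      qed
      then have "D X \<subseteq> D Y" unfolding D_def[of Y] by blast
      then have "vec.dim (D X) \<le> vec.dim (D Y)" by (rule vec.dim_subset)
      then show False using rank[OF X] rank[OF Y] less by linarith
    qed
  qed
qed

end
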